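(* Let $X$ be a uniformly convex normed space, $\eta:(0,2]\to(0,1]$ a modulus of uniform convexity of $X$, and $T:X\to X$ a nonexpansive mapping such that $Fix(T)\neq\emptyset$. Let $(r_n)_{n\in\mathbb{N}}\subseteq X$ and $(\alpha_n)_{n\in\mathbb{N}},(\beta_n)_{n\in\mathbb{N}}\subseteq[0,1]$ be such that $\alpha_n+\beta_n\le 1$ for all $n\in\mathbb{N}$, and let $(x_n)$ be given by $x_0=x\in X$ and $x_{n+1}=\alpha_nx_n+\beta_nTx_n+r_n$ for all $n\in\mathbb{N}$. Suppose that $\sigma_1,\sigma_2,\sigma_3:\mathbb{N}\to\mathbb{N}$ are such that: (C1) $\sum_{n=0}^\infty(1-\alpha_n-\beta_n)<\infty$ with Cauchy modulus $\sigma_1$; (C2) $\alpha_n+\beta_n>0$ for all $n\in\mathbb{N}$ and $\sum_{n=0}^\infty\frac{\alpha_n\beta_n}{\alpha_n+\beta_n}=\infty$ with rate of divergence $\sigma_2$; (C3) $\sum_{n=0}^\infty\|r_n\|<\infty$ with Cauchy modulus $\sigma_3$. Let $M_{\alpha,\beta},M_r\in\mathbb{N}$ satisfy $\sum_{n=0}^\infty(1-\alpha_n-\beta_n)\le M_{\alpha,\beta}$ and $\sum_{n=0}^\infty\|r_n\|\le M_r$, and let $b,M_0,M\in\mathbb{N}^*$ be such that, for some fixed point $z$ of $T$, $$b\ge\max\{\|x-z\|,\|z\|\},\quad M_0=b+M_{\alpha,\beta}b+M_r,\quad M=M_0+b.$$ Define $\Omega,\Phi,\Psi:\mathbb{N}\to\mathbb{N}$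 by $$\Omega(k)=\left\lceil\frac{(M_0+M_{\alpha,\beta}b+M_r+1)(k+1)}{\eta\left(\frac{1}{M_0(k+1)}\right)}\right\rceil,$$ $$\Phi(k)=\sigma_2\big(\Omega(2k+1)+\max\{\sigma_1(8M(k+1)-1),\sigma_3(8k+7)\}+1\big),\qquad \Psi(k)=\Phi(2k+1).$$ Then $(x_n)$ is $T$-asymptotically regular with rate $\Phi$ and asymptotically regular with rate $\Psi$.
   Context: $\mathbb{N}=\{0,1,2,\dots\}$, $\mathbb{N}^*=\mathbb{N}\setminus\{0\}$. $T$ is nonexpansive if $\|Tx-Ty\|\le\|x-y\|$ for all $x,y$; $Fix(T)$ is its set of fixed points. A modulus of uniform convexity of a normed space $X$ is a map $\eta:(0,2]\to(0,1]$ such that for all $\varepsilon\in(0,2]$ and $x,y\in X$: $\|x\|\le1$, $\|y\|\le1$ and $\|x-y\|\ge\varepsilon$ imply $\|\frac12(x+y)\|\le1-\eta(\varepsilon)$. $X$ is uniformly convex iff it has such a modulus. A function $\varphi:\mathbb{N}\to\mathbb{N}$ is a rate of convergence of a real sequence $(a_n)$ towards $a$ if for all $k$, $|a_n-a|\le\frac1{k+1}$ for all $n\ge\varphi(k)$; it is a Cauchy modulus of $(a_n)$ if for all $k$, $|a_{n+p}-a_n|\le\frac1{k+1}$ for all $n\ge\varphi(k)$ and all $p\in\mathbb{N}$. A Cauchy modulus of a series $\sum a_n$ is a Cauchy modulus of its sequence of partial sums $\left(\sum_{i=0}^n a_i\right)_n$. A rate of divergence of a divergent series $\sum a_n$ is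 $\theta:\mathbb{N}\to\mathbb{N}$ with $\sum_{i=0}^{\theta(k)}a_i\ge k$ for all $k\in\mathbb{N}$. $(x_n)$ is $T$-asymptotically regular with rate $\Phi$ if $\Phi$ is a rate of convergence of $(\|x_n-Tx_n\|)$ towards $0$; it is asymptotically regular with rate $\Psi$ if $\Psi$ is a rate of convergence of $(\|x_{n+1}-x_n\|)$ towards $0$. *)

theory Defs
  imports "HOL-Analysis.Analysis"
begin

text \<open>The space \<open>X\<close> is the whole type \<open>'a\<close>. A modulus \<open>\<eta> : (0,2] \<rightarrow> (0,1]\<close> is a
  function on all reals whose values outside \<open>(0,2]\<close> are irrelevant.\<close>

definition modulus_of_uniform_convexity ::
    "'a::real_normed_vector itself \<Rightarrow> (real \<Rightarrow> real) \<Rightarrow> bool" where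
  "modulus_of_uniform_convexity _ \<eta> \<longleftrightarrow>
     (\<forall>\<epsilon>\<in>{0<..2}. \<eta> \<epsilon> \<in> {0<..1}) \<and>
     (\<forall>\<epsilon>\<in>{0<..2}. \<forall>x y :: 'a. norm x \<le> 1 \<longrightarrow> norm y \<le> 1 \<longrightarrow> norm (x - y) \<ge> \<epsilon> \<longrightarrow>
        norm ((1/2) *\<^sub>R (x + y)) \<le> 1 - \<eta> \<epsilon>)"

definition uniformly_convex :: "'a::real_normed_vector itself \<Rightarrow> bool" where
  "uniformly_convex X \<longleftrightarrow> (\<exists>\<eta>. modulus_of_uniform_convexity X \<eta>)"

definition nonexpansive :: "('a::real_normed_vector \<Rightarrow> 'a) \<Rightarrow> bool" where
  "nonexpansive T \<longleftrightarrow> (\<forall>x y. norm (T x - T y) \<le> norm (x - y))"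

definition Fix :: "('a \<Rightarrow> 'a) \<Rightarrow> 'a set" where
  "Fix T = {z. T z = z}"

definition rate_of_convergence :: "(nat \<Rightarrow> nat) \<Rightarrow> (nat \<Rightarrow> real) \<Rightarrow> real \<Rightarrow> bool" where
  "rate_of_convergence \<phi> a l \<longleftrightarrow> (\<forall>k. \<forall>n\<ge>\<phi> k. \<bar>a n - l\<bar> \<le> 1 / (real k + 1))"

definition cauchy_modulus :: "(nat \<Rightarrow> nat) \<Rightarrow> (nat \<Rightarrow> real) \<Rightarrow> bool" where
  "cauchy_modulus \<phi> a \<longleftrightarrow> (\<forall>k. \<forall>n\<ge>\<phi> k. \<forall>p. \<bar>a (n + p) - a n\<bar> \<le> 1 / (real k + 1))"

definition series_cauchy_modulus :: "(nat \<Rightarrow> nat) \<Rightarrow> (nat \<Rightarrow> real) \<Rightarrow> bool" where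
  "series_cauchy_modulus \<phi> a \<longleftrightarrow> cauchy_modulus \<phi> (\<lambda>n. \<Sum>i\<le>n. a i)"

definition rate_of_divergence :: "(nat \<Rightarrow> nat) \<Rightarrow> (nat \<Rightarrow> real) \<Rightarrow> bool" where
  "rate_of_divergence \<theta> a \<longleftrightarrow> (\<forall>k. (\<Sum>i\<le>\<theta> k. a i) \<ge> real k)"

definition T_asymptotically_regular_with_rate ::
    "('a::real_normed_vector \<Rightarrow> 'a) \<Rightarrow> (nat \<Rightarrow> 'a) \<Rightarrow> (nat \<Rightarrow> nat) \<Rightarrow> bool" where
  "T_asymptotically_regular_with_rate T x \<Phi> \<longleftrightarrow>
     rate_of_convergence \<Phi> (\<lambda>n. norm (x n - T (x n))) 0"

definition asymptotically_regular_with_rate ::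
    "(nat \<Rightarrow> 'a::real_normed_vector) \<Rightarrow> (nat \<Rightarrow> nat) \<Rightarrow> bool" where
  "asymptotically_regular_with_rate x \<Psi> \<longleftrightarrow>
     rate_of_convergence \<Psi> (\<lambda>n. norm (x (Suc n) - x n)) 0"

end

theory Submission
  imports Defs
begin

text \<open>Fix a fixed point \<open>z\<close> of \<open>T\<close> and write \<open>\<gamma>\<^sub>n = \<alpha>\<^sub>n + \<beta>\<^sub>n\<close>. Up to the summable errors
  \<open>(1 - \<gamma>\<^sub>n) \<parallel>z\<parallel> + \<parallel>r\<^sub>n\<parallel>\<close> the distance \<open>\<parallel>x\<^sub>n - z\<parallel>\<close> is nonincreasing, and as long as
  \<open>\<parallel>x\<^sub>n - T x\<^sub>n\<parallel> \<ge> \<epsilon>\<close> uniform convexity makes it drop by at least a constant multiple of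
  \<open>\<alpha>\<^sub>n \<beta>\<^sub>n / \<gamma>\<^sub>n\<close>. Since these terms have divergent sum, \<open>\<parallel>x\<^sub>n - T x\<^sub>n\<parallel> < \<epsilon>\<close> has to occur
  within a computable window beginning after the Cauchy moduli have taken effect. As
  \<open>\<parallel>x\<^sub>n - T x\<^sub>n\<parallel>\<close> is itself nonincreasing up to summable errors, it stays small from then on.\<close>

section \<open>Uniform convexity on balls of any radius and for unequal weights\<close>

lemma modulus_of_uniform_convexity_convex_combination:
  fixes a c :: "'a::real_normed_vector"
  assumes "modulus_of_uniform_convexity TYPE('a) \<eta>"
    and "0 < \<epsilon>" "\<epsilon> \<le> 2" "0 < \<rho>" "norm a \<le> \<rho>" "norm c \<le> \<rho>" "\<epsilon> * \<rho> \<le> norm (a - c)"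
    and "0 \<le> t" "t \<le> 1"
  shows "norm ((1 - t) *\<^sub>R a + t *\<^sub>R c) \<le> \<rho> - 2 * (t * (1 - t)) * \<rho> * \<eta> \<epsilon>"
proof -
  have \<eta>: "0 < \<eta> \<epsilon>"
    and conv: "\<And>u v :: 'a. \<lbrakk>norm u \<le> 1; norm v \<le> 1; \<epsilon> \<le> norm (u - v)\<rbrakk>
                 \<Longrightarrow> norm ((1/2) *\<^sub>R (u + v)) \<le> 1 - \<eta> \<epsilon>"
    using assms(1-3) unfolding modulus_of_uniform_convexity_def by auto
  \<comment> \<open>Division by \<open>\<rho>\<close> moves \<open>a\<close> and \<open>c\<close>
    into the unit ball at distance at least \<open>\<epsilon>\<close>; scaling back gives
    \<open>mid\<close>.\<close>
  have "norm ((1/2) *\<^sub>R ((1/\<rho>) *\<^sub>R a + (1/\<rho>) *\<^sub>R c)) \<le> 1 - \<eta> \<epsilon>"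
  proof (rule conv)
    have "norm ((1/\<rho>) *\<^sub>R a - (1/\<rho>) *\<^sub>R c) = norm (a - c) / \<rho>"
      using \<open>0 < \<rho>\<close> by (simp flip: scaleR_diff_right)
    moreover have "\<epsilon> \<le> norm (a - c) / \<rho>"
      using assms by (simp add: pos_le_divide_eq)
    ultimately show "\<epsilon> \<le> norm ((1/\<rho>) *\<^sub>R a - (1/\<rho>) *\<^sub>R c)"
      by (simp only:)
  qed (use assms in \<open>simp_all add: field_simps\<close>)
  also have "(1/2) *\<^sub>R ((1/\<rho>) *\<^sub>R a + (1/\<rho>) *\<^sub>R c) = (1/\<rho>) *\<^sub>R ((1/2) *\<^sub>R (a + c))"
    by (simp add: algebra_simps)
  also have "norm \<dots> = norm ((1/2) *\<^sub>R (a + c)) / \<rho>"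
    using \<open>0 < \<rho>\<close> unfolding norm_scaleR[of "1/\<rho>"] by simp
  finally have mid: "norm ((1/2) *\<^sub>R (a + c)) \<le> \<rho> - \<rho> * \<eta> \<epsilon>"
    using \<open>0 < \<rho>\<close> by (simp only: pos_divide_le_eq left_diff_distrib mult_1 mult.commute[of "\<eta> \<epsilon>"])
  \<comment> \<open>For \<open>\<mu> \<le> 1/2\<close> the point is a convex combination of
    \<open>u\<close> and the midpoint, with weight \<open>2 * \<mu>\<close> on the latter, so it
    inherits that share of the midpoint's gain. The extra factor \<open>1 - \<mu>\<close> weakens
    the bound but makes it symmetric, so that \<open>t > 1/2\<close> follows by swapping
    \<open>a\<close> and \<open>c\<close>.\<close>
  have half: "norm ((1 - \<mu>) *\<^sub>R u + \<mu> *\<^sub>R v) \<le> \<rho> - 2 * (\<mu> * (1 - \<mu>)) * \<rho> * \<eta> \<epsilon>"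
    if "0 \<le> \<mu>" "\<mu> \<le> 1/2" "norm u \<le> \<rho>" "norm ((1/2) *\<^sub>R (u + v)) \<le> \<rho> - \<rho> * \<eta> \<epsilon>"
    for \<mu> and u v :: 'a
  proof -
    have "(1 - \<mu>) *\<^sub>R u + \<mu> *\<^sub>R v = (1 - 2 * \<mu>) *\<^sub>R u + (2 * \<mu>) *\<^sub>R ((1/2) *\<^sub>R (u + v))"
      by (simp add: algebra_simps flip: scaleR_add_left)
    also have "norm \<dots> \<le> (1 - 2 * \<mu>) * norm u + (2 * \<mu>) * norm ((1/2) *\<^sub>R (u + v))"
      using that by (intro norm_triangle_le) simp
    also have "\<dots> \<le> (1 - 2 * \<mu>) * \<rho> + (2 * \<mu>) * (\<rho> - \<rho> * \<eta> \<epsilon>)"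
      using that by (intro add_mono mult_left_mono) auto
    also have "\<dots> = \<rho> - 2 * \<mu> * (\<rho> * \<eta> \<epsilon>)"
      by (simp add: algebra_simps)
    also have "\<dots> \<le> \<rho> - 2 * \<mu> * (1 - \<mu>) * (\<rho> * \<eta> \<epsilon>)"
    proof -
      have "2 * \<mu> * (1 - \<mu>) * (\<rho> * \<eta> \<epsilon>) \<le> 2 * \<mu> * (\<rho> * \<eta> \<epsilon>)"
        using that \<eta> \<open>0 < \<rho>\<close> by (intro mult_right_mono) (auto simp: mult_left_le)
      then show ?thesis by simp
    qed
    finally show ?thesis by (simp add: mult.assoc)
  qed
  show ?thesis
  proof (cases "t \<le> 1/2")
    case True
    then show ?thesis using half[of t a c] mid assms by simp
  next
    case False
    then show ?thesis
      using half[of "1 - t" c a] mid assms by (simp add: add.commute mult.commute)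
  qed
qed

section \<open>Estimates for a single step of the iteration\<close>

lemma perturbed_combination_diff_le:
  fixes u v r z :: "'a::real_normed_vector"
  assumes "a + b \<le> 1"
  shows "norm (a *\<^sub>R u + b *\<^sub>R v + r - z)
    \<le> norm (a *\<^sub>R (u - z) + b *\<^sub>R (v - z)) + ((1 - a - b) * norm z + norm r)"
proof -
  \<comment> \<open>As \<open>a + b\<close> may be less than 1, distributing \<open>z\<close> over
    the two terms leaves the defect \<open>(1 - a - b) *\<^sub>R z\<close>, which joins the error
    \<open>r\<close>.\<close>
  have "a *\<^sub>R u + b *\<^sub>R v + r - z =
      (a *\<^sub>R (u - z) + b *\<^sub>R (v - z)) + (r - (1 - a - b) *\<^sub>R z)"
    by (simp add: algebra_simps)
  also have "norm \<dots> \<le> norm (a *\<^sub>R (u - z) + b *\<^sub>R (v - z))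
      + (norm r + norm ((1 - a - b) *\<^sub>R z))"
    by (intro order.trans[OF norm_triangle_ineq] add_left_mono norm_triangle_ineq4)
  finally show ?thesis using assms by simp
qed

lemma perturbed_mann_step_le:
  fixes T :: "'a::real_normed_vector \<Rightarrow> 'a"
  assumes "nonexpansive T" "T z = z" "0 \<le> a" "0 \<le> b" "a + b \<le> 1"
  shows "norm (a *\<^sub>R u + b *\<^sub>R T u + r - z) \<le> norm (u - z) + ((1 - a - b) * norm z + norm r)"
proof -
  have "norm (T u - z) \<le> norm (u - z)"
    using assms(1,2) unfolding nonexpansive_def by metis
  then have "a * norm (u - z) + b * norm (T u - z) \<le> a * norm (u - z) + b * norm (u - z)"
    using assms by (intro add_left_mono mult_left_mono) auto
  also have "\<dots> = (a + b) * norm (u - z)"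
    by (simp add: algebra_simps)
  also have "\<dots> \<le> norm (u - z)"
    using assms by (intro mult_left_le_one_le) auto
  finally have "norm (a *\<^sub>R (u - z) + b *\<^sub>R (T u - z)) \<le> norm (u - z)"
    using assms by (intro order.trans[OF norm_triangle_ineq]) simp
  then show ?thesis
    using perturbed_combination_diff_le[of a b u "T u" r z] assms by linarith
qed

text \<open>Division by \<open>a + b\<close> turns the step into a convex combination with weight
  \<open>t = b / (a + b)\<close>, and scaling back turns \<open>t * (1 - t)\<close> into
  \<open>a * b / (a + b)\<close>. The ball has the actual radius \<open>norm (u - z)\<close>, but
  \<open>\<eta>\<close> is evaluated at \<open>\<epsilon> / R\<close>, so that one \<open>R\<close>
  yields the same gain factor for all iterates.\<close>

lemma perturbed_mann_step_decrease:
  fixes T :: "'a::real_normed_vector \<Rightarrow> 'a"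
  assumes modulus: "modulus_of_uniform_convexity TYPE('a) \<eta>"
    and T: "nonexpansive T" "T z = z"
    and ab: "0 \<le> a" "0 \<le> b" "0 < a + b" "a + b \<le> 1"
    and R: "norm (u - z) \<le> R" and \<epsilon>: "0 < \<epsilon>" "\<epsilon> \<le> norm (u - T u)"
  shows "norm (a *\<^sub>R u + b *\<^sub>R T u + r - z)
    \<le> norm (u - z) + ((1 - a - b) * norm z + norm r) - \<epsilon> * \<eta> (\<epsilon> / R) * (a * b / (a + b))"
proof -
  define \<rho> where "\<rho> = norm (u - z)"
  have Tu: "norm (T u - z) \<le> \<rho>"
    using T unfolding nonexpansive_def \<rho>_def by metis
  \<comment> \<open>Both \<open>u\<close> and \<open>T u\<close> lie within \<open>\<rho>\<close> of
    \<open>z\<close>. The resulting \<open>\<epsilon> \<le> 2 * \<rho>\<close> makes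
    \<open>\<rho>\<close> positive, puts \<open>\<epsilon> / R\<close> into the domain of
    \<open>\<eta>\<close>, and lets \<open>\<epsilon>\<close> replace \<open>2 * \<rho>\<close> in
    the gain.\<close>
  have "norm (u - T u) \<le> 2 * \<rho>"
    using Tu norm_triangle_ineq4[of "u - z" "T u - z"] by (simp add: \<rho>_def)
  then have \<rho>: "\<epsilon> \<le> 2 * \<rho>" using \<epsilon> by simp
  then have "0 < \<rho>" using \<epsilon> by simp
  then have "0 < R" using R unfolding \<rho>_def by linarith
  have \<epsilon>R: "0 < \<epsilon> / R" "\<epsilon> / R \<le> 2"
    using \<epsilon> \<rho> R \<open>0 < R\<close> by (auto simp: \<rho>_def divide_simps)
  then have \<eta>: "0 < \<eta> (\<epsilon> / R)"
    using modulus unfolding modulus_of_uniform_convexity_def by auto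
  define t where "t = b / (a + b)"
  have t: "1 - t = a / (a + b)" "0 \<le> t" "t \<le> 1"
    using ab by (auto simp: t_def field_simps)
  have "\<epsilon> / R * \<rho> \<le> norm ((u - z) - (T u - z))"
  proof -
    have "\<epsilon> / R * \<rho> \<le> \<epsilon>"
      using R \<epsilon> \<open>0 < R\<close> by (simp add: \<rho>_def field_simps)
    then show ?thesis using \<epsilon> by simp
  qed
  then have "norm ((1 - t) *\<^sub>R (u - z) + t *\<^sub>R (T u - z))
      \<le> \<rho> - 2 * (t * (1 - t)) * \<rho> * \<eta> (\<epsilon> / R)"
    using \<open>0 < \<rho>\<close> \<epsilon>R t Tu
    by (intro modulus_of_uniform_convexity_convex_combination[OF modulus]) (auto simp: \<rho>_def)
  also have "\<dots> = \<rho> - (2 * \<rho>) * (t * (1 - t) * \<eta> (\<epsilon> / R))"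
    by simp
  also have "\<dots> \<le> \<rho> - \<epsilon> * (t * (1 - t) * \<eta> (\<epsilon> / R))"
    using \<rho> \<eta> t(2,3) by (intro diff_left_mono mult_right_mono) auto
  finally have "(a + b) * norm ((1 - t) *\<^sub>R (u - z) + t *\<^sub>R (T u - z))
      \<le> (a + b) * (\<rho> - \<epsilon> * (t * (1 - t) * \<eta> (\<epsilon> / R)))"
    using ab by (intro mult_left_mono) auto
  also have "\<dots> = (a + b) * \<rho> - \<epsilon> * \<eta> (\<epsilon> / R) * ((a + b) * t * (1 - t))"
    by (simp add: algebra_simps)
  also have "(a + b) * t * (1 - t) = a * b / (a + b)"
    unfolding t(1) using ab by (simp add: t_def)
  also have "(a + b) * norm ((1 - t) *\<^sub>R (u - z) + t *\<^sub>R (T u - z))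
      = norm ((a + b) *\<^sub>R ((1 - t) *\<^sub>R (u - z) + t *\<^sub>R (T u - z)))"
    using ab by simp
  also have "(a + b) *\<^sub>R ((1 - t) *\<^sub>R (u - z) + t *\<^sub>R (T u - z))
      = a *\<^sub>R (u - z) + b *\<^sub>R (T u - z)"
    unfolding t(1) scaleR_add_right using ab by (simp add: t_def)
  finally have "norm (a *\<^sub>R (u - z) + b *\<^sub>R (T u - z))
      \<le> \<rho> - \<epsilon> * \<eta> (\<epsilon> / R) * (a * b / (a + b))"
    using mult_left_le_one_le[of \<rho> "a + b"] \<open>0 < \<rho>\<close> ab by linarith
  then show ?thesis
    using perturbed_combination_diff_le[of a b u "T u" r z] ab by (simp add: \<rho>_def)
qed

lemma perturbed_mann_step_displacement:
  fixes T :: "'a::real_normed_vector \<Rightarrow> 'a"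
  assumes "0 \<le> b" "a + b \<le> 1" "norm u \<le> C"
  shows "norm (a *\<^sub>R u + b *\<^sub>R T u + r - u)
    \<le> b * norm (u - T u) + (1 - a - b) * C + norm r"
proof -
  have "a *\<^sub>R u + b *\<^sub>R T u + r - u = (r - b *\<^sub>R (u - T u)) - (1 - a - b) *\<^sub>R u"
    by (simp add: algebra_simps)
  also have "norm \<dots> \<le> norm r + norm (b *\<^sub>R (u - T u)) + norm ((1 - a - b) *\<^sub>R u)"
    by (intro norm_triangle_le_diff add_right_mono norm_triangle_ineq4)
  also have "\<dots> \<le> norm r + b * norm (u - T u) + (1 - a - b) * C"
    using assms by (auto intro!: mult_left_mono)
  finally show ?thesis by simp
qed

text \<open>Going from \<open>v\<close> to \<open>T u\<close> costs \<open>a\<close> times the old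
  residual; going on to \<open>T v\<close> costs at most \<open>norm (v - u)\<close>, hence
  \<open>b\<close> times it. Together this is at most the old residual, and each half adds one error
  \<open>(1 - a - b) * C + norm r\<close>.\<close>

lemma perturbed_mann_step_residual:
  fixes T :: "'a::real_normed_vector \<Rightarrow> 'a"
  assumes "nonexpansive T" "0 \<le> a" "0 \<le> b" "a + b \<le> 1" "norm u \<le> C" "norm (T u) \<le> C"
    and v: "v = a *\<^sub>R u + b *\<^sub>R T u + r"
  shows "norm (v - T v) \<le> norm (u - T u) + (2 * C * (1 - a - b) + 2 * norm r)"
proof -
  have "v - T u = (r + a *\<^sub>R (u - T u)) - (1 - a - b) *\<^sub>R T u"
    by (simp add: v algebra_simps)
  also have "norm \<dots> \<le> norm r + norm (a *\<^sub>R (u - T u)) + norm ((1 - a - b) *\<^sub>R T u)"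
    by (intro norm_triangle_le_diff add_right_mono norm_triangle_ineq)
  also have "\<dots> \<le> norm r + a * norm (u - T u) + (1 - a - b) * C"
    using assms by (auto intro!: mult_left_mono)
  finally have 1: "norm (v - T u) \<le> norm r + a * norm (u - T u) + (1 - a - b) * C" .
  have 2: "norm (v - u) \<le> b * norm (u - T u) + (1 - a - b) * C + norm r"
    unfolding v using assms by (intro perturbed_mann_step_displacement)
  have "norm (v - T v) \<le> norm (v - T u) + norm (T v - T u)"
    using norm_triangle_ineq4[of "v - T u" "T v - T u"] by simp
  also have "norm (T v - T u) \<le> norm (v - u)"
    using assms unfolding nonexpansive_def by blast
  finally have "norm (v - T v) \<le> (a + b) * norm (u - T u) + 2 * C * (1 - a - b) + 2 * norm r"
    using 1 2 by (simp add: algebra_simps)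
  moreover have "(a + b) * norm (u - T u) \<le> norm (u - T u)"
    using assms by (intro mult_left_le_one_le) auto
  ultimately show ?thesis by simp
qed

section \<open>Summation of stepwise bounds and tails of series\<close>

lemma le_add_sum_of_step_le:
  fixes f e :: "nat \<Rightarrow> real"
  assumes "\<And>i. m \<le> i \<Longrightarrow> i < n \<Longrightarrow> f (Suc i) \<le> f i + e i" "m \<le> n"
  shows "f n \<le> f m + sum e {m..<n}"
  using assms(2,1)
proof (induction n rule: dec_induct)
  case (step n)
  then have "f n \<le> f m + sum e {m..<n}" "f (Suc n) \<le> f n + e n" by auto
  then show ?case using step.hyps by (simp add: sum.atLeastLessThan_Suc)
qed simp

text \<open>The inequality \<open>\<sigma> k < m\<close> is strict because the sum from
  \<open>m\<close> on is a difference of partial sums starting at index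
  \<open>m - 1\<close>.\<close>

lemma series_cauchy_modulus_sum_le:
  assumes "series_cauchy_modulus \<sigma> f" "\<sigma> k < m"
  shows "sum f {m..<n} \<le> 1 / (real k + 1)"
proof (cases "m < n")
  case True
  define p where "p = n - m"
  have "\<bar>(\<Sum>i\<le>m - 1 + p. f i) - (\<Sum>i\<le>m - 1. f i)\<bar> \<le> 1 / (real k + 1)"
    using assms unfolding series_cauchy_modulus_def cauchy_modulus_def
    by (metis Suc_pred' le_less_trans less_Suc_eq_le zero_le)
  moreover have "{..m - 1 + p} = {..m - 1} \<union> {m..<n}"
    using assms(2) True by (auto simp: p_def)
  then have "(\<Sum>i\<le>m - 1 + p. f i) = (\<Sum>i\<le>m - 1. f i) + sum f {m..<n}"
    using assms(2) by (auto intro!: sum.union_disjoint)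
  ultimately show ?thesis by simp
qed simp

section \<open>The rates for the iteration\<close>

theorem theorem4p1:
  fixes \<eta> :: "real \<Rightarrow> real"
    and T :: "'a::real_normed_vector \<Rightarrow> 'a"
    and r x :: "nat \<Rightarrow> 'a"
    and x0 :: 'a
    and \<alpha> \<beta> :: "nat \<Rightarrow> real"
    and \<sigma>1 \<sigma>2 \<sigma>3 \<Omega> \<Phi> \<Psi> :: "nat \<Rightarrow> nat"
    and M\<alpha>\<beta> Mr b M0 M :: nat
  assumes uc: "uniformly_convex TYPE('a)"
    and modulus: "modulus_of_uniform_convexity TYPE('a) \<eta>"
    and nonexp: "nonexpansive T"
    and fix_nonempty: "Fix T \<noteq> {}"
    and alpha: "\<And>n. \<alpha> n \<in> {0..1}"
    and beta: "\<And>n. \<beta> n \<in> {0..1}"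
    and alpha_beta: "\<And>n. \<alpha> n + \<beta> n \<le> 1"
    and x_0: "x 0 = x0"
    and x_Suc: "\<And>n. x (Suc n) = \<alpha> n *\<^sub>R x n + \<beta> n *\<^sub>R T (x n) + r n"
    and C1: "summable (\<lambda>n. 1 - \<alpha> n - \<beta> n)"
            "series_cauchy_modulus \<sigma>1 (\<lambda>n. 1 - \<alpha> n - \<beta> n)"
    and C2: "\<And>n. \<alpha> n + \<beta> n > 0"
            "filterlim (\<lambda>n. \<Sum>i\<le>n. \<alpha> i * \<beta> i / (\<alpha> i + \<beta> i)) at_top sequentially"
            "rate_of_divergence \<sigma>2 (\<lambda>n. \<alpha> n * \<beta> n / (\<alpha> n + \<beta> n))"
    and C3: "summable (\<lambda>n. norm (r n))"
            "series_cauchy_modulus \<sigma>3 (\<lambda>n. norm (r n))"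
    and M\<alpha>\<beta>: "(\<Sum>n. 1 - \<alpha> n - \<beta> n) \<le> real M\<alpha>\<beta>"
    and Mr: "(\<Sum>n. norm (r n)) \<le> real Mr"
    and positive: "b > 0" "M0 > 0" "M > 0"
    and b: "\<exists>z\<in>Fix T. real b \<ge> max (norm (x0 - z)) (norm z)"
    and M0: "M0 = b + M\<alpha>\<beta> * b + Mr"
    and M: "M = M0 + b"
    and \<Omega>: "\<And>k. \<Omega> k = nat \<lceil>(real M0 + real M\<alpha>\<beta> * real b + real Mr + 1) * (real k + 1)
                          / \<eta> (1 / (real M0 * (real k + 1)))\<rceil>"
    and \<Phi>: "\<And>k. \<Phi> k = \<sigma>2 (\<Omega> (2 * k + 1)
                          + max (\<sigma>1 (8 * M * (k + 1) - 1)) (\<sigma>3 (8 * k + 7)) + 1)"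
    and \<Psi>: "\<And>k. \<Psi> k = \<Phi> (2 * k + 1)"
  shows "T_asymptotically_regular_with_rate T x \<Phi> \<and> asymptotically_regular_with_rate x \<Psi>"
proof -
  obtain z where z: "T z = z" "norm (x0 - z) \<le> b" "norm z \<le> b"
    using b by (auto simp: Fix_def)
  define e where "e i = (1 - \<alpha> i - \<beta> i) * real b + norm (r i)" for i
  define c where "c i = \<alpha> i * \<beta> i / (\<alpha> i + \<beta> i)" for i
  have \<alpha>\<beta>: "0 \<le> \<alpha> i" "0 \<le> \<beta> i" "\<beta> i \<le> 1" "0 < \<alpha> i + \<beta> i" "\<alpha> i + \<beta> i \<le> 1"
    "0 \<le> 1 - \<alpha> i - \<beta> i" for i
    using alpha[of i] beta[of i] alpha_beta[of i] C2(1)[of i] by auto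
  have e0: "0 \<le> e i" for i
    using \<alpha>\<beta>(6)[of i] by (simp add: e_def)
  have c0: "0 \<le> c i" for i
    using \<alpha>\<beta>[of i] by (simp add: c_def)
  have c1: "c i \<le> 1" for i
  proof -
    have "\<alpha> i * \<beta> i \<le> \<alpha> i" using \<alpha>\<beta>[of i] by (simp add: mult_left_le)
    then show ?thesis using \<alpha>\<beta>[of i] by (simp add: c_def)
  qed
  have sum_e: "sum e A \<le> real M\<alpha>\<beta> * real b + real Mr" if "finite A" for A
  proof -
    have "(\<Sum>i\<in>A. 1 - \<alpha> i - \<beta> i) \<le> real M\<alpha>\<beta>"
      using sum_le_suminf[OF C1(1) that] \<alpha>\<beta>(6) M\<alpha>\<beta> by force
    then have "(\<Sum>i\<in>A. 1 - \<alpha> i - \<beta> i) * real b \<le> real M\<alpha>\<beta> * real b"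
      by (intro mult_right_mono) auto
    moreover have "(\<Sum>i\<in>A. norm (r i)) \<le> real Mr"
      using sum_le_suminf[OF C3(1) that] Mr by force
    ultimately show ?thesis
      unfolding e_def by (simp add: sum.distrib sum_distrib_right)
  qed
  have err: "(1 - \<alpha> i - \<beta> i) * norm z + norm (r i) \<le> e i" for i
    unfolding e_def using z \<alpha>\<beta>(6)[of i] by (intro add_right_mono mult_left_mono) auto
  have "norm (x (Suc i) - z) \<le> norm (x i - z) + e i" for i
    using perturbed_mann_step_le[OF nonexp z(1) \<alpha>\<beta>(1,2,5), of i "x i" "r i"] err[of i]
    by (simp add: x_Suc)
  then have "norm (x n - z) \<le> norm (x 0 - z) + sum e {0..<n}" for n
    by (intro le_add_sum_of_step_le[where f = "\<lambda>n. norm (x n - z)"]) auto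
  \<comment> \<open>\<open>M0\<close> is the bound on the initial distance plus the bound on all
    errors together.\<close>
  then have xz: "norm (x n - z) \<le> M0" for n
    using sum_e[of "{0..<n}"] z(2) by (smt (verit) M0 x_0 finite_atLeastLessThan of_nat_add of_nat_mult)
  have bnd: "norm u \<le> M" if "norm (u - z) \<le> M0" for u
    using that z(3) norm_triangle_ineq[of "u - z" z] by (simp add: M)
  have x_bnd: "norm (x n) \<le> M" "norm (T (x n)) \<le> M" for n
    using xz[of n] nonexp z(1) unfolding nonexpansive_def
    by (auto intro!: bnd) (metis order.trans)

  \<comment> \<open>Otherwise each step of the window lowers the distance to \<open>z\<close> by
    \<open>\<epsilon> * h * c i\<close> up to errors. The budget \<open>D\<close>, distance at entry
    plus all errors, is then overdrawn: \<open>\<Omega> k\<close> is chosen to make the total loss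
    at least \<open>D + 1\<close>.\<close>
  have hit: "\<exists>n. m < n \<and> n \<le> \<sigma>2 (\<Omega> k + m + 1) \<and> norm (x n - T (x n)) \<le> 1 / (real k + 1)" for m k
  proof (rule ccontr)
    assume none: "\<not> ?thesis"
    define P where "P = \<sigma>2 (\<Omega> k + m + 1)"
    define \<epsilon> where "\<epsilon> = 1 / (real k + 1)"
    have \<epsilon>: "0 < \<epsilon>" "\<epsilon> \<le> 1" by (auto simp: \<epsilon>_def)
    have large: "\<epsilon> \<le> norm (x n - T (x n))" if "m < n" "n \<le> P" for n
      using none that by (force simp: P_def \<epsilon>_def)
    define h where "h = \<eta> (\<epsilon> / real M0)"
    have "0 < \<epsilon> / real M0" "\<epsilon> / real M0 \<le> 2"
      using \<epsilon> positive by (auto simp: divide_simps)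
    then have h: "0 < h"
      using modulus unfolding modulus_of_uniform_convexity_def h_def by auto
    define D where "D = real M0 + real M\<alpha>\<beta> * real b + real Mr"
    have D: "0 \<le> D" by (simp add: D_def)
    have "\<Omega> k = nat \<lceil>(D + 1) * (real k + 1) / h\<rceil>"
      by (simp add: \<Omega> D_def h_def \<epsilon>_def mult.commute)
    then have \<Omega>_ge: "(D + 1) * (real k + 1) / h \<le> real (\<Omega> k)"
      by linarith
    \<comment> \<open>The rate of divergence counts from index 0. The summand \<open>m + 1\<close>
      pays for the terms up to \<open>m\<close>, each at most 1.\<close>
    have "real (\<Omega> k + m + 1) \<le> sum c {..P}"
      using C2(3) unfolding rate_of_divergence_def P_def c_def by blast
    also have "\<dots> \<le> sum c ({..m} \<union> {Suc m..<Suc P})"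
      using c0 by (intro sum_mono2) auto
    also have "\<dots> = sum c {..m} + sum c {Suc m..<Suc P}"
      by (intro sum.union_disjoint) auto
    also have "sum c {..m} \<le> real (Suc m)"
      using sum_bounded_above[of "{..m}" c 1] c1 by simp
    finally have sum_c: "real (\<Omega> k) \<le> sum c {Suc m..<Suc P}" by simp
    \<comment> \<open>A window with \<open>P < m\<close> would make the sum over it zero, against
      the positive lower bound.\<close>
    have "0 < (D + 1) * (real k + 1) / h"
      using h D by simp
    then have "Suc m \<le> Suc P"
      using sum_c \<Omega>_ge by (cases "Suc m \<le> Suc P") auto
    have "norm (x (Suc P) - z)
        \<le> norm (x (Suc m) - z) + (\<Sum>i = Suc m..<Suc P. e i - \<epsilon> * h * c i)"
    proof (rule le_add_sum_of_step_le[where f = "\<lambda>n. norm (x n - z)"])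
      fix i assume "Suc m \<le> i" "i < Suc P"
      then have "\<epsilon> \<le> norm (x i - T (x i))" by (intro large) auto
      from perturbed_mann_step_decrease[OF modulus nonexp z(1) \<alpha>\<beta>(1,2,4,5) xz \<epsilon>(1) this,
          of i "r i"]
      show "norm (x (Suc i) - z) \<le> norm (x i - z) + (e i - \<epsilon> * h * c i)"
        using err[of i] by (simp add: x_Suc h_def c_def)
    qed fact
    also have "\<dots> = norm (x (Suc m) - z) + sum e {Suc m..<Suc P}
        - \<epsilon> * h * sum c {Suc m..<Suc P}"
      unfolding sum_subtractf sum_distrib_left by simp
    also have "\<dots> \<le> D - \<epsilon> * h * sum c {Suc m..<Suc P}"
      using xz[of "Suc m"] sum_e[of "{Suc m..<Suc P}"] by (simp add: D_def)
    also have "\<dots> \<le> D - \<epsilon> * h * ((D + 1) * (real k + 1) / h)"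
      using sum_c \<Omega>_ge \<epsilon> h by (intro diff_left_mono mult_left_mono) auto
    also have "\<epsilon> * h * ((D + 1) * (real k + 1) / h) = D + 1"
      using h by (simp add: \<epsilon>_def)
    finally show False using norm_ge_zero[of "x (Suc P) - z"] by linarith
  qed

  \<comment> \<open>With \<open>8 * M * (k + 1) - 1\<close> and \<open>8 * k + 7\<close> the moduli
    give \<open>1 / (8 * M * (k + 1))\<close> and \<open>1 / (8 * (k + 1))\<close>; the factor
    \<open>M\<close> in the first cancels the later multiplication by \<open>M\<close>.\<close>
  define \<mu> where "\<mu> k = max (\<sigma>1 (8 * M * (k + 1) - 1)) (\<sigma>3 (8 * k + 7))" for k
  have tails: "M * (\<Sum>i = m..<n. 1 - \<alpha> i - \<beta> i) \<le> 1 / (8 * (real k + 1))"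
    "(\<Sum>i = m..<n. norm (r i)) \<le> 1 / (8 * (real k + 1))" if "\<mu> k < m" for m n k
  proof -
    have "real (8 * M * (k + 1) - 1) + 1 = M * (8 * (real k + 1))"
      using positive by (subst of_nat_diff) (auto simp: algebra_simps)
    then have "(\<Sum>i = m..<n. 1 - \<alpha> i - \<beta> i) \<le> 1 / (M * (8 * (real k + 1)))"
      using series_cauchy_modulus_sum_le[OF C1(2), of "8 * M * (k + 1) - 1" m n] that
      by (simp add: \<mu>_def)
    from mult_left_mono[OF this, of "real M"]
    show "M * (\<Sum>i = m..<n. 1 - \<alpha> i - \<beta> i) \<le> 1 / (8 * (real k + 1))"
      using positive by simp
    show "(\<Sum>i = m..<n. norm (r i)) \<le> 1 / (8 * (real k + 1))"
      using series_cauchy_modulus_sum_le[OF C3(2), of "8 * k + 7" m n] that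
      by (simp add: \<mu>_def algebra_simps)
  qed
  have \<Phi>_bound: "\<mu> k < n \<and> norm (x n - T (x n)) \<le> 1 / (real k + 1)" if n: "\<Phi> k \<le> n" for k n
  proof -
    \<comment> \<open>The window supplies half of \<open>1 / (k + 1)\<close>; the two tails, each
      doubled, supply a quarter each.\<close>
    obtain n0 where n0: "\<mu> k < n0" "n0 \<le> \<Phi> k" "norm (x n0 - T (x n0)) \<le> 1 / (real (2 * k + 1) + 1)"
      using hit[of "\<mu> k" "2 * k + 1"] by (auto simp: \<Phi> \<mu>_def)
    have "norm (x n - T (x n)) \<le> norm (x n0 - T (x n0))
        + (\<Sum>i = n0..<n. 2 * M * (1 - \<alpha> i - \<beta> i) + 2 * norm (r i))"
      using n0 n perturbed_mann_step_residual[OF nonexp \<alpha>\<beta>(1,2,5) x_bnd x_Suc]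
      by (intro le_add_sum_of_step_le[where f = "\<lambda>n. norm (x n - T (x n))"]) auto
    also have "(\<Sum>i = n0..<n. 2 * M * (1 - \<alpha> i - \<beta> i) + 2 * norm (r i))
        = 2 * (M * (\<Sum>i = n0..<n. 1 - \<alpha> i - \<beta> i)) + 2 * (\<Sum>i = n0..<n. norm (r i))"
      by (simp add: sum.distrib sum_distrib_left mult.assoc)
    also have "norm (x n0 - T (x n0)) + \<dots>
        \<le> 1 / (real (2 * k + 1) + 1) + (2 * (1 / (8 * (real k + 1))) + 2 * (1 / (8 * (real k + 1))))"
      using n0 tails[OF n0(1), of n] by (intro add_mono mult_left_mono) auto
    also have "\<dots> = 1 / (real k + 1)"
      by (simp add: divide_simps) algebra
    finally show ?thesis using n0 n by simp
  qed
  have "T_asymptotically_regular_with_rate T x \<Phi>"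
    using \<Phi>_bound unfolding T_asymptotically_regular_with_rate_def rate_of_convergence_def by simp
  moreover have "norm (x (Suc n) - x n) \<le> 1 / (real k + 1)" if "\<Psi> k \<le> n" for k n
  proof -
    \<comment> \<open>Half of \<open>1 / (k + 1)\<close> goes to the residual. The two error terms
      at \<open>n\<close> are tails of length one, each at most \<open>1 / (16 * (k + 1))\<close>,
      which is why \<open>\<Phi>_bound\<close> also records \<open>\<mu> k < n\<close>.\<close>
    define j where "j = 2 * k + 1"
    have n: "\<mu> j < n" "norm (x n - T (x n)) \<le> 1 / (real j + 1)"
      using \<Phi>_bound[of j n] that by (auto simp: \<Psi> j_def)
    have "norm (x (Suc n) - x n)
        \<le> \<beta> n * norm (x n - T (x n)) + (1 - \<alpha> n - \<beta> n) * M + norm (r n)"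
      unfolding x_Suc using \<alpha>\<beta> x_bnd by (intro perturbed_mann_step_displacement) auto
    also have "\<beta> n * norm (x n - T (x n)) \<le> norm (x n - T (x n))"
      using \<alpha>\<beta>[of n] by (intro mult_left_le_one_le) auto
    finally have "norm (x (Suc n) - x n)
        \<le> 1 / (real j + 1) + 1 / (8 * (real j + 1)) + 1 / (8 * (real j + 1))"
      using n tails[OF n(1), of "Suc n"] by (simp add: mult.commute)
    also have "\<dots> \<le> 1 / (real k + 1)"
      by (simp add: j_def divide_simps) (simp add: algebra_simps)
    finally show ?thesis .
  qed
  then have "asymptotically_regular_with_rate x \<Psi>"
    unfolding asymptotically_regular_with_rate_def rate_of_convergence_def by simp
  ultimately show ?thesis ..
qed

end
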